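(* Let $\{X_1,X_2,\dots\}$ be pairwise uncorrelated random variables satisfying $$\sum_{n=1}^{\infty}\frac{\mathrm{Var}(X_n)}{n}<\infty$$ and $E(X_n)\to 0$ as $n\to\infty$. Then $\frac{S_n}{n}$ converges completely to $0$.
   Context: All random variables are real-valued and defined on a common probability space $(\Omega,\mathcal{F},P)$; $E$ denotes expectation and $\mathrm{Var}$ denotes variance (the $X_n$ have finite second moments, so that variances and covariances are defined and finite). $S_n=\sum_{k=1}^n X_k$ for $n\ge 1$. Pairwise uncorrelated means $\mathrm{Cov}(X_i,X_j)=0$ for all $i\neq j$. A sequence of random variables $\{Y_n,n\ge1\}$ is said to converge completely to a random variable $Y$ if for every $\varepsilon>0$, $\sum_{n=1}^{\infty}P\{|Y_n-Y|\geq\varepsilon\}<\infty$. *)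

theory Defs
  imports "HOL-Probability.Probability"
begin

definition covariance :: "'a measure \<Rightarrow> ('a \<Rightarrow> real) \<Rightarrow> ('a \<Rightarrow> real) \<Rightarrow> real" where
  "covariance M X Y =
     prob_space.expectation M
       (\<lambda>\<omega>. (X \<omega> - prob_space.expectation M X) * (Y \<omega> - prob_space.expectation M Y))"

text \<open>Sequences of random variables are indexed by the integers \<open>n \<ge> 1\<close>, as a function on
  \<^typ>\<open>nat\<close> whose value at 0 is irrelevant; series \<open>n = 1, 2, \<dots>\<close> are written with
  \<^const>\<open>Suc\<close>.\<close>

definition pairwise_uncorrelated :: "'a measure \<Rightarrow> (nat \<Rightarrow> 'a \<Rightarrow> real) \<Rightarrow> bool" where
  "pairwise_uncorrelated M X \<longleftrightarrow>
     (\<forall>i\<ge>1. \<forall>j\<ge>1. i \<noteq> j \<longrightarrow> covariance M (X i) (X j) = 0)"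

text \<open>Measurability is part of the definition because \<^const>\<open>measure\<close> is 0 on
  non-measurable sets.\<close>

definition converges_completely ::
  "'a measure \<Rightarrow> (nat \<Rightarrow> 'a \<Rightarrow> real) \<Rightarrow> ('a \<Rightarrow> real) \<Rightarrow> bool" where
  "converges_completely M Y Z \<longleftrightarrow>
     (\<forall>n\<ge>1. Y n \<in> borel_measurable M) \<and> Z \<in> borel_measurable M \<and>
     (\<forall>\<epsilon>>0. summable (\<lambda>n. measure M {\<omega> \<in> space M. \<bar>Y (Suc n) \<omega> - Z \<omega>\<bar> \<ge> \<epsilon>}))"

end

theory Submission
  imports Defs
begin

text \<open>Since the variables are uncorrelated, \<open>Var(S\<^sub>n)\<close> is the sum of the variances, so Chebyshev's
  inequality bounds the probability that \<open>S\<^sub>n / n\<close> deviates from its mean by \<open>\<epsilon> / 2\<close> by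
  \<open>4 / (\<epsilon>\<^sup>2 n\<^sup>2) \<cdot> (Var(X\<^sub>1) + \<dots> + Var(X\<^sub>n))\<close>. Interchanging the order of summation, the tail of
  \<open>\<Sum> 1 / n\<^sup>2\<close> from \<open>k\<close> on being \<open>O(1 / k)\<close>, these bounds are summable. The means of \<open>S\<^sub>n / n\<close> tend
  to 0 by Cesaro's theorem, so they are eventually below \<open>\<epsilon> / 2\<close>.\<close>

text \<open>From some \<open>N\<close> on every term is below \<open>e / 2\<close> in absolute
  value; the finitely many earlier terms contribute at most a constant \<open>K\<close>, which
  division by \<open>n\<close> makes negligible.\<close>

lemma tendsto_zero_arithmetic_mean:
  fixes a :: "nat \<Rightarrow> real"
  assumes "a \<longlonglongrightarrow> 0"
  shows "(\<lambda>n. (\<Sum>k=1..n. a k) / real n) \<longlonglongrightarrow> 0"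
proof (rule LIMSEQ_I)
  fix e :: real
  assume e: "0 < e"
  then obtain N where N: "\<And>k. k \<ge> N \<Longrightarrow> \<bar>a k\<bar> < e / 2"
    using LIMSEQ_D[OF assms, of "e / 2"] by auto
  define K where "K = (\<Sum>k<N. \<bar>a k\<bar>)"
  have bound: "\<bar>\<Sum>k=1..n. a k\<bar> \<le> K + real n * (e / 2)" for n
  proof -
    have "\<bar>\<Sum>k=1..n. a k\<bar> \<le> (\<Sum>k=1..n. \<bar>a k\<bar>)"
      by (rule sum_abs)
    also have "\<dots> \<le> (\<Sum>k=1..n. (if k < N then \<bar>a k\<bar> else 0) + e / 2)"
      using e N by (intro sum_mono) (auto simp: not_less less_imp_le)
    also have "\<dots> = (\<Sum>k\<in>{1..n} \<inter> {k. k < N}. \<bar>a k\<bar>) + real n * (e / 2)"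
      by (simp add: sum.distrib sum.inter_restrict)
    also have "\<dots> \<le> K + real n * (e / 2)"
      unfolding K_def by (intro add_right_mono sum_mono2) auto
    finally show ?thesis .
  qed
  \<comment> \<open>For \<open>n\<close> beyond this threshold \<open>K < n * e / 2\<close>, so the
    early terms use less than the other half of \<open>e\<close>.\<close>
  obtain m :: nat where m: "real m > 2 * K / e"
    using reals_Archimedean2 by blast
  have "norm ((\<Sum>k=1..n. a k) / real n - 0) < e" if "n \<ge> Suc m" for n
  proof -
    have "2 * K / e < real n"
      using m that by linarith
    then have "K + real n * (e / 2) < real n * e"
      using e by (simp add: field_simps)
    then have "\<bar>\<Sum>k=1..n. a k\<bar> < real n * e"
      using bound[of n] by linarith
    then show ?thesis
      using that by (simp add: field_simps)
  qed
  then show "\<exists>no. \<forall>n\<ge>no. norm ((\<Sum>k=1..n. a k) / real n - 0) < e"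
    by blast
qed

text \<open>Each \<open>v k\<close> has total weight \<Sum> 1 / (n + 1)^2 over n \<ge> k, which is
  at most 2 / (k + 1). An induction over the partial sums replaces the interchange of two infinite
  sums.\<close>

lemma summable_partial_sums_over_squares:
  fixes v :: "nat \<Rightarrow> real"
  assumes nonneg: "\<And>n. 0 \<le> v n"
    and summable: "summable (\<lambda>n. v n / real (Suc n))"
  shows "summable (\<lambda>n. (\<Sum>k\<le>n. v k) / (real (Suc n))\<^sup>2)"
proof (rule summableI_nonneg_bounded)
  show "0 \<le> (\<Sum>k\<le>n. v k) / (real (Suc n))\<^sup>2" for n
    using nonneg by (simp add: sum_nonneg)
next
  fix N
  \<comment> \<open>The second summand on the left bounds the contribution of \<open>v 0, \<dots>, v (N - 1)\<close> to the
    rest of the series.\<close>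
  have "(\<Sum>n<N. (\<Sum>k\<le>n. v k) / (real (Suc n))\<^sup>2) + (\<Sum>k<N. v k) / real N
    \<le> 2 * (\<Sum>n<N. v n / real (Suc n))"
  proof (induction N)
    case 0
    then show ?case by simp
  next
    case (Suc N)
    define U where "U = (\<Sum>k<N. v k)"
    have U: "U \<ge> 0"
      unfolding U_def using nonneg by (simp add: sum_nonneg)
    \<comment> \<open>Telescoping: 1 / (N + 1)^2 \<le> 1 / N - 1 / (N + 1) for N > 0. For
      \<open>N = 0\<close>, where \<open>1 / real N\<close> is 0, the bound survives because
      \<open>U\<close> is an empty sum.\<close>
    have "U * (1 / (real (Suc N))\<^sup>2 + 1 / real (Suc N)) \<le> U * (1 / real N)"
    proof (cases "N = 0")
      case True
      then show ?thesis by (simp add: U_def)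
    next
      case False
      then have "1 / (real (Suc N))\<^sup>2 + 1 / real (Suc N) \<le> 1 / real N"
        by (simp add: divide_simps power2_eq_square) (simp add: algebra_simps)
      then show ?thesis using U by (rule mult_left_mono)
    qed
    \<comment> \<open>The new term enters both the series and the reserve for its tail, each time
      with weight at most 1 / (N + 1); hence the factor 2.\<close>
    moreover have "v N * (1 / (real (Suc N))\<^sup>2 + 1 / real (Suc N)) \<le> v N * (2 / real (Suc N))"
      using nonneg
      by (intro mult_left_mono) (simp_all add: divide_simps power2_eq_square)
    moreover have "(\<Sum>k\<le>N. v k) = U + v N" "(\<Sum>k<Suc N. v k) = U + v N"
      by (simp_all add: U_def flip: lessThan_Suc_atMost)
    ultimately show ?case
      using Suc.IH by (simp add: U_def[symmetric] algebra_simps add_divide_distrib)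
  qed
  moreover have "0 \<le> (\<Sum>k<N. v k) / real N"
    using nonneg by (simp add: sum_nonneg)
  moreover have "(\<Sum>n<N. v n / real (Suc n)) \<le> (\<Sum>n. v n / real (Suc n))"
    using nonneg by (intro sum_le_suminf summable) auto
  ultimately show "(\<Sum>n<N. (\<Sum>k\<le>n. v k) / (real (Suc n))\<^sup>2) \<le> 2 * (\<Sum>n. v n / real (Suc n))"
    by linarith
qed

text \<open>The integrable majorant is f^2 + g^2, as 2|ab| \<le> a^2 + b^2. This justifies
  integrating expanded squares of sums term by term.\<close>

lemma integrable_mult_of_square_integrable:
  fixes f g :: "'a \<Rightarrow> real"
  assumes [measurable]: "f \<in> borel_measurable M" "g \<in> borel_measurable M"
    and "integrable M (\<lambda>x. (f x)\<^sup>2)" "integrable M (\<lambda>x. (g x)\<^sup>2)"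
  shows "integrable M (\<lambda>x. f x * g x)"
proof (rule Bochner_Integration.integrable_bound)
  show "integrable M (\<lambda>x. (f x)\<^sup>2 + (g x)\<^sup>2)"
    using assms by simp
  have "\<bar>a * b\<bar> \<le> a\<^sup>2 + b\<^sup>2" for a b :: real
    using sum_squares_bound[of "\<bar>a\<bar>" "\<bar>b\<bar>"] abs_ge_zero[of "a * b"]
    unfolding abs_mult power2_abs mult.assoc by linarith
  then show "AE x in M. norm (f x * g x) \<le> norm ((f x)\<^sup>2 + (g x)\<^sup>2)"
    by simp
qed simp

context prob_space
begin

lemma square_integrable_sum:
  fixes X :: "'i \<Rightarrow> 'a \<Rightarrow> real"
  assumes "\<And>i. i \<in> I \<Longrightarrow> random_variable borel (X i)"
    and "\<And>i. i \<in> I \<Longrightarrow> integrable M (\<lambda>\<omega>. (X i \<omega>)\<^sup>2)"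
  shows "integrable M (\<lambda>\<omega>. (\<Sum>i\<in>I. X i \<omega>)\<^sup>2)"
  unfolding power2_eq_square sum_product
  using assms by (intro Bochner_Integration.integrable_sum integrable_mult_of_square_integrable)

text \<open>Expanding the square of the sum of the centred variables gives the double sum of
  covariances, of which only the diagonal survives.\<close>

lemma variance_sum_uncorrelated:
  fixes X :: "'i \<Rightarrow> 'a \<Rightarrow> real"
  assumes "finite I"
    and meas: "\<And>i. i \<in> I \<Longrightarrow> random_variable borel (X i)"
    and sq: "\<And>i. i \<in> I \<Longrightarrow> integrable M (\<lambda>\<omega>. (X i \<omega>)\<^sup>2)"
    and uncorr: "\<And>i j. i \<in> I \<Longrightarrow> j \<in> I \<Longrightarrow> i \<noteq> j \<Longrightarrow> covariance M (X i) (X j) = 0"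
  shows "variance (\<lambda>\<omega>. \<Sum>i\<in>I. X i \<omega>) = (\<Sum>i\<in>I. variance (X i))"
proof -
  let ?Y = "\<lambda>i \<omega>. X i \<omega> - expectation (X i)"
  have int: "integrable M (X i)" if "i \<in> I" for i
    using meas[OF that] sq[OF that] by (rule square_integrable_imp_integrable)
  have sqY: "integrable M (\<lambda>\<omega>. (?Y i \<omega>)\<^sup>2)" if "i \<in> I" for i
    using int[OF that] sq[OF that] by (simp add: power2_diff)
  have prod: "integrable M (\<lambda>\<omega>. ?Y i \<omega> * ?Y j \<omega>)" if "i \<in> I" "j \<in> I" for i j
    using that meas sqY by (intro integrable_mult_of_square_integrable) auto
  have "variance (\<lambda>\<omega>. \<Sum>i\<in>I. X i \<omega>) = expectation (\<lambda>\<omega>. (\<Sum>i\<in>I. ?Y i \<omega>)\<^sup>2)"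
    using int by (simp add: sum_subtractf)
  also have "\<dots> = (\<Sum>i\<in>I. \<Sum>j\<in>I. covariance M (X i) (X j))"
    unfolding power2_eq_square sum_product covariance_def
    by (simp add: prod)
  also have "\<dots> = (\<Sum>i\<in>I. \<Sum>j\<in>I. if i = j then variance (X i) else 0)"
    using uncorr by (intro sum.cong refl) (simp, simp add: covariance_def power2_eq_square)
  also have "\<dots> = (\<Sum>i\<in>I. variance (X i))"
    using \<open>finite I\<close> by simp
  finally show ?thesis .
qed

end

theorem corollary2p6:
  fixes M :: "'a measure" and X :: "nat \<Rightarrow> 'a \<Rightarrow> real"
  assumes "prob_space M"
    and "\<And>n. n \<ge> 1 \<Longrightarrow> X n \<in> borel_measurable M"
    and "\<And>n. n \<ge> 1 \<Longrightarrow> integrable M (\<lambda>\<omega>. (X n \<omega>)\<^sup>2)"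
    and "pairwise_uncorrelated M X"
    and "summable (\<lambda>n. prob_space.variance M (X (Suc n)) / real (Suc n))"
    and "(\<lambda>n. prob_space.expectation M (X n)) \<longlonglongrightarrow> 0"
  shows "converges_completely M (\<lambda>n \<omega>. (\<Sum>k=1..n. X k \<omega>) / real n) (\<lambda>\<omega>. 0)"
proof -
  interpret prob_space M by fact
  define S where "S n \<omega> = (\<Sum>k=1..n. X k \<omega>)" for n \<omega>
  \<comment> \<open>The shift matches series indexed from 0 and keeps the irrelevant
    \<open>X 0\<close> out.\<close>
  define v where "v n = variance (X (Suc n))" for n
  have S_meas: "random_variable borel (S n)" for n
    unfolding S_def using assms(2) by (intro borel_measurable_sum) auto
  have S_sq: "integrable M (\<lambda>\<omega>. (S n \<omega>)\<^sup>2)" for n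
    unfolding S_def using assms(2,3) by (intro square_integrable_sum) auto
  have "integrable M (X k)" if "k \<ge> 1" for k
    using assms(2)[OF that] assms(3)[OF that] by (rule square_integrable_imp_integrable)
  then have S_mean: "expectation (S n) = (\<Sum>k=1..n. expectation (X k))" for n
    unfolding S_def by (intro Bochner_Integration.integral_sum) auto
  have "variance (S n) = (\<Sum>k=1..n. variance (X k))" for n
    unfolding S_def using assms(2-4)
    by (intro variance_sum_uncorrelated) (auto simp: pairwise_uncorrelated_def)
  then have S_var: "variance (S (Suc n)) = (\<Sum>k\<le>n. v k)" for n
    by (simp add: v_def sum.shift_bounds_cl_Suc_ivl atLeast0AtMost del: sum.cl_ivl_Suc)
  have "(\<lambda>n. expectation (S n) / real n) \<longlonglongrightarrow> 0"
    unfolding S_mean by (rule tendsto_zero_arithmetic_mean) fact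
  then have means: "(\<lambda>n. expectation (S (Suc n)) / real (Suc n)) \<longlonglongrightarrow> 0"
    by (rule LIMSEQ_Suc)
  have bounds: "summable (\<lambda>n. (\<Sum>k\<le>n. v k) / (real (Suc n))\<^sup>2)"
    using assms(5) by (intro summable_partial_sums_over_squares) (simp_all add: v_def)
  have "summable (\<lambda>n. prob {\<omega> \<in> space M. \<bar>S (Suc n) \<omega> / real (Suc n) - 0\<bar> \<ge> \<epsilon>})"
    if "\<epsilon> > 0" for \<epsilon>
  \<comment> \<open>The comparison can only be eventual: Chebyshev's inequality controls deviations
    from the mean, and the mean is within \<open>\<epsilon> / 2\<close> of 0 only for large
    \<open>n\<close>.\<close>
  proof (rule summable_comparison_test_ev)
    show "summable (\<lambda>n. 4 / \<epsilon>\<^sup>2 * ((\<Sum>k\<le>n. v k) / (real (Suc n))\<^sup>2))"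
      by (intro summable_mult bounds)
    have "eventually (\<lambda>n. \<bar>expectation (S (Suc n)) / real (Suc n)\<bar> < \<epsilon> / 2) sequentially"
      using tendstoD[OF means, of "\<epsilon> / 2"] \<open>\<epsilon> > 0\<close> by (simp add: dist_real_def)
    then show "eventually (\<lambda>n. norm (prob {\<omega> \<in> space M. \<bar>S (Suc n) \<omega> / real (Suc n) - 0\<bar> \<ge> \<epsilon>})
      \<le> 4 / \<epsilon>\<^sup>2 * ((\<Sum>k\<le>n. v k) / (real (Suc n))\<^sup>2)) sequentially"
    proof eventually_elim
      case (elim n)
      define r where "r = real (Suc n)"
      define m where "m = expectation (S (Suc n))"
      have r: "r > 0" by (simp add: r_def)
      have m: "\<bar>m\<bar> < \<epsilon> / 2 * r"
        using elim r unfolding r_def[symmetric] m_def[symmetric] by (simp add: field_simps)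
      \<comment> \<open>By the triangle inequality, |s| \<ge> \<epsilon> r and |m| < \<epsilon> r /
        2 leave a deviation |s - m| of at least \<epsilon> r / 2.\<close>
      have "prob {\<omega> \<in> space M. \<bar>S (Suc n) \<omega> / r\<bar> \<ge> \<epsilon>}
        \<le> prob {\<omega> \<in> space M. \<epsilon> / 2 * r \<le> \<bar>S (Suc n) \<omega> - m\<bar>}"
      proof (rule finite_measure_mono)
        have "\<epsilon> / 2 * r \<le> \<bar>s - m\<bar>" if "\<bar>s / r\<bar> \<ge> \<epsilon>" for s
        proof -
          have "\<epsilon> * r \<le> \<bar>s\<bar>"
            using that r by (simp add: field_simps)
          then show ?thesis
            using m by linarith
        qed
        then show "{\<omega> \<in> space M. \<bar>S (Suc n) \<omega> / r\<bar> \<ge> \<epsilon>}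
          \<subseteq> {\<omega> \<in> space M. \<epsilon> / 2 * r \<le> \<bar>S (Suc n) \<omega> - m\<bar>}"
          by blast
        show "{\<omega> \<in> space M. \<epsilon> / 2 * r \<le> \<bar>S (Suc n) \<omega> - m\<bar>} \<in> events"
          using S_meas by measurable
      qed
      also have "\<dots> \<le> variance (S (Suc n)) / (\<epsilon> / 2 * r)\<^sup>2"
        unfolding m_def using r \<open>\<epsilon> > 0\<close> S_meas S_sq by (intro Chebyshev_inequality) auto
      also have "\<dots> = 4 / \<epsilon>\<^sup>2 * ((\<Sum>k\<le>n. v k) / r\<^sup>2)"
        unfolding S_var by (simp add: field_simps)
      finally show ?case
        by (simp add: r_def)
    qed
  qed
  then show ?thesis
    using S_meas by (auto simp: converges_completely_def S_def[abs_def])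
qed

end
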